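(* Let $m,n$ be positive integers and let $k$ be an integer with $0\le k\le\min(m,n)$. Let $z_1,\dots,z_n$ and $\alpha_1,\dots,\alpha_m$ be independent indeterminates. The following identity of rational functions holds: $$ \sum_{S\in\binom{[n]}{k}} \frac{\displaystyle \prod_{i\in S}(1-z_i)^{n-k}\ \prod_{j\in\overline{S}}\ \prod_{i=1}^m (z_j\oplus\alpha_i)} {\displaystyle \prod_{i\in S}\ \prod_{j\in\overline{S}}(z_j-z_i)} = \sum_{T\in\binom{[m]}{k}} \frac{\displaystyle \prod_{i\in T}(1-\alpha_i)^{m-k}\ \prod_{j\in\overline{T}}\ \prod_{i=1}^n (z_i\oplus\alpha_j)} {\displaystyle \prod_{i\in T}\ \prod_{j\in\overline{T}}(\alpha_j-\alpha_i)}, $$ where $\overline{S}=\{1,\dots,n\}\setminus S$ for $S\subseteq[n]$ and $\overline{T}=\{1,\dots,m\}\setminus T$ for $T\subseteq[m]$.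
   Context: Here $\beta=-1$, so $z\oplus\alpha:=z+\alpha-z\alpha$. For a positive integer $r$, $[r]=\{1,2,\dots,r\}$ and $\binom{[r]}{k}$ denotes the set of $k$-element subsets of $[r]$. Empty products are equal to $1$. *)

theory Defs
  imports
    "HOL-Library.Poly_Mapping"
    "HOL-Computational_Algebra.Polynomial_Factorial"
begin

datatype indet = Z nat | Alpha nat

text \<open>
  The library's integral domain instance for \<open>_ \<Rightarrow>\<^sub>0 _\<close> needs a linear order on the
  exponent vectors, hence on the indeterminates. The order has no mathematical meaning here;
  it only makes the fraction field below available.
\<close>

fun indet_code :: "indet \<Rightarrow> nat" where
  "indet_code (Z i) = 2 * i"
| "indet_code (Alpha j) = 2 * j + 1"

lemma indet_code_inject: "indet_code x = indet_code y \<longleftrightarrow> x = y"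
  by (cases x; cases y) (simp; presburger)+

instantiation indet :: linorder
begin

definition less_eq_indet :: "indet \<Rightarrow> indet \<Rightarrow> bool" where
  "x \<le> y \<longleftrightarrow> indet_code x \<le> indet_code y"

definition less_indet :: "indet \<Rightarrow> indet \<Rightarrow> bool" where
  "x < y \<longleftrightarrow> indet_code x < indet_code y"

instance
  by standard (auto simp: less_eq_indet_def less_indet_def indet_code_inject)

end

text \<open>
  Polynomials in the \<open>indet\<close>s are finitely supported maps from exponent vectors to
  coefficients; rational functions form the fraction field of this domain. There are countably
  many indeterminates, so that \<open>m\<close> and \<open>n\<close> can be arbitrary natural numbers.
\<close>

type_synonym 'c ratfun = "((indet \<Rightarrow>\<^sub>0 nat) \<Rightarrow>\<^sub>0 'c) fract"

definition indet_fun :: "indet \<Rightarrow> 'c::idom ratfun" where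
  "indet_fun x = to_fract (Poly_Mapping.single (Poly_Mapping.single x 1) 1)"

abbreviation zvar :: "nat \<Rightarrow> 'c::idom ratfun" where
  "zvar i \<equiv> indet_fun (Z i)"

abbreviation avar :: "nat \<Rightarrow> 'c::idom ratfun" where
  "avar j \<equiv> indet_fun (Alpha j)"

text \<open>The operation \<open>x + y + \<beta> x y\<close> at \<open>\<beta> = -1\<close>.\<close>

definition oplus :: "'a::comm_ring_1 \<Rightarrow> 'a \<Rightarrow> 'a" (infixl \<open>\<oplus>\<close> 65) where
  "x \<oplus> y = x + y - x * y"

end

theory Submission
  imports Defs
begin

text \<open>
  Put \<open>u\<^sub>i = 1 - z\<^sub>i\<close> and \<open>v\<^sub>j = 1 - \<alpha>\<^sub>j\<close>. Then \<open>z\<^sub>i \<oplus> \<alpha>\<^sub>j = 1 - u\<^sub>i v\<^sub>j\<close> and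
  \<open>z\<^sub>j - z\<^sub>i = u\<^sub>i - u\<^sub>j\<close>, and both sides of the identity become the same expression
  \<open>subset_sum\<close>, evaluated at \<open>(U, V)\<close> and at \<open>(V, U)\<close> respectively, where \<open>U\<close> and \<open>V\<close> are
  the finite sets of the \<open>u\<^sub>i\<close> and the \<open>v\<^sub>j\<close>. The claim is thus a symmetry
  (lemma \<open>subset_sum_commute\<close>), which holds over every field as long as \<open>0 \<notin> U\<close> and no product
  \<open>u v\<close> equals 1.

  The symmetry is proved by induction on \<open>k\<close>. For \<open>k = 0\<close> both sides are the product of all
  \<open>1 - u v\<close>. For the step, single out an element \<open>x\<close> of \<open>V = insert x W\<close> and regard both sides as
  rational functions of \<open>x\<close>, with \<open>U\<close> and \<open>W\<close> fixed. After multiplication by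
  \<open>\<Prod>v\<in>W. (x - v)\<close> both become polynomials in \<open>x\<close> of degree less than \<open>card U + card W\<close>
  (\<open>degree_cleared_snd_poly\<close>, where \<open>k \<ge> 1\<close> matters, and \<open>degree_cleared_fst_poly\<close>),
  so it is enough to compare them at \<open>card U + card W\<close> distinct points:

  \<^item> At \<open>x = 1 / a\<close> with \<open>a \<in> U\<close>, the factor \<open>1 - a x\<close> vanishes. The surviving summands are
    those whose subset contains \<open>a\<close> (on the one side) or \<open>x\<close> (on the other), and in these all
    factors that involve \<open>a\<close> or \<open>x\<close> cancel. What remains is the identity for \<open>U - {a}\<close>, \<open>W\<close>
    and \<open>k - 1\<close> (\<open>subset_sum_insert_inverse\<close>).

  \<^item> At \<open>x \<in> W\<close> both polynomials vanish. On one side this is clear from the factor just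
    introduced; on the other it says that the apparent poles of the sum cancel, because
    exchanging the roles of the two colliding elements pairs up the summands with opposite
    residues (\<open>poly_cleared_fst_poly_root\<close>).
\<close>

section \<open>Weighted sums over subsets of given size\<close>

definition weight :: "'a::field set \<Rightarrow> 'a set \<Rightarrow> 'a set \<Rightarrow> 'a" where
  "weight A B S = (\<Prod>u\<in>S. u ^ (card A - card S)) * (\<Prod>w\<in>A - S. \<Prod>v\<in>B. 1 - w * v)
     / (\<Prod>u\<in>S. \<Prod>w\<in>A - S. u - w)"

abbreviation subsets_of_card :: "'a set \<Rightarrow> nat \<Rightarrow> 'a set set" where
  "subsets_of_card A k \<equiv> {S. S \<subseteq> A \<and> card S = k}"

definition subset_sum :: "'a::field set \<Rightarrow> 'a set \<Rightarrow> nat \<Rightarrow> 'a" where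
  "subset_sum A B k = (\<Sum>S\<in>subsets_of_card A k. weight A B S)"

lemma sum_subsets_of_card_insert:
  assumes "finite A" "x \<notin> A"
  shows "(\<Sum>S\<in>subsets_of_card (insert x A) (Suc k). f S)
    = (\<Sum>S\<in>subsets_of_card A (Suc k). f S) + (\<Sum>S\<in>subsets_of_card A k. f (insert x S))"
proof -
  have 1: "subsets_of_card (insert x A) (Suc k)
    = subsets_of_card A (Suc k) \<union> insert x ` subsets_of_card A k" (is "?L = ?R")
  proof
    show "?L \<subseteq> ?R"
    proof
      fix S assume S: "S \<in> ?L"
      then have "finite S" using assms finite_subset by blast
      show "S \<in> ?R"
      proof (cases "x \<in> S")
        case True
        then have "S = insert x (S - {x})" "S - {x} \<in> subsets_of_card A k"
          using S \<open>finite S\<close> by auto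
        then show ?thesis by blast
      next
        case False
        then show ?thesis using S by auto
      qed
    qed
    show "?R \<subseteq> ?L"
      using assms by (auto simp: card_insert_if finite_subset)
  qed
  have 2: "inj_on (insert x) (subsets_of_card A k)"
    using assms(2) by (intro inj_onI) (metis (no_types, lifting) insert_ident mem_Collect_eq subsetD)
  show ?thesis
    unfolding 1 using assms
    by (subst sum.union_disjoint) (auto simp: sum.reindex[OF 2])
qed

text \<open>
  How a weight changes when an element joins the second set, the ground set together with the
  chosen subset, or the ground set alone. These three rules
  carry both the cancellation of the poles and the evaluation at inverses.
\<close>

lemma weight_insert_snd:
  assumes "finite B" "x \<notin> B"
  shows "weight A (insert x B) S = weight A B S * (\<Prod>w\<in>A - S. 1 - w * x)"
  using assms by (simp add: weight_def prod.distrib)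

lemma weight_insert_both:
  assumes "finite A" "x \<notin> A" "S \<subseteq> A"
  shows "weight (insert x A) B (insert x S)
    = weight A B S * (x ^ card (A - S) / (\<Prod>w\<in>A - S. x - w))"
proof -
  have "finite S" "x \<notin> S" using assms finite_subset by auto
  moreover have "insert x A - insert x S = A - S" using assms by auto
  moreover have "card (A - S) = card A - card S" using \<open>finite S\<close> assms by (simp add: card_Diff_subset)
  ultimately show ?thesis using assms
    by (simp add: weight_def mult_ac)
qed

lemma weight_insert_fst:
  assumes "finite A" "x \<notin> A" "S \<subseteq> A"
  shows "weight (insert x A) B S
    = weight A B S * (\<Prod>v\<in>S. v / (v - x)) * (\<Prod>v\<in>B. 1 - x * v)"
proof -
  have "finite S" "x \<notin> S" using assms finite_subset by auto
  moreover have "insert x A - S = insert x (A - S)" using assms \<open>x \<notin> S\<close> by auto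
  moreover have "card (insert x A) - card S = Suc (card A - card S)"
    using assms by (simp add: Suc_diff_le card_mono)
  ultimately show ?thesis using assms
    by (simp add: weight_def prod.distrib prod_dividef mult_ac)
qed

section \<open>Clearing denominators in one variable\<close>

text \<open>
  For \<open>x \<notin> V\<close>, the values of the next two polynomials at \<open>x\<close> are
  \<open>subset_sum U (insert x V) k\<close> and \<open>subset_sum (insert x V) U (Suc k)\<close>, each times
  \<open>\<Prod>v\<in>V. (x - v)\<close>. In the second one, the first sum collects the subsets without \<open>x\<close>, the
  second sum those with \<open>x\<close>. The factors \<open>-v\<close> arise as \<open>v / (v - x) * (x - v)\<close>.
\<close>

definition cleared_snd_poly :: "'a::field set \<Rightarrow> 'a set \<Rightarrow> nat \<Rightarrow> 'a poly" where
  "cleared_snd_poly U V k = (\<Prod>v\<in>V. [:-v, 1:]) *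
     (\<Sum>S\<in>subsets_of_card U k. smult (weight U V S) (\<Prod>w\<in>U - S. [:1, -w:]))"

definition cleared_fst_poly :: "'a::field set \<Rightarrow> 'a set \<Rightarrow> nat \<Rightarrow> 'a poly" where
  "cleared_fst_poly U V k =
     (\<Sum>T\<in>subsets_of_card V (Suc k). smult (weight V U T * (\<Prod>v\<in>T. -v))
        ((\<Prod>u\<in>U. [:1, -u:]) * (\<Prod>v\<in>V - T. [:-v, 1:])))
   + (\<Sum>T\<in>subsets_of_card V k. smult (weight V U T)
        ([:0, 1:] ^ card (V - T) * (\<Prod>v\<in>T. [:-v, 1:])))"

lemma poly_cleared_snd_poly:
  assumes "finite U" "finite V" "x \<notin> V"
  shows "poly (cleared_snd_poly U V k) x = (\<Prod>v\<in>V. x - v) * subset_sum U (insert x V) k"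
  using assms
  by (simp add: cleared_snd_poly_def subset_sum_def poly_prod poly_sum weight_insert_snd mult.commute[of x])

lemma prod_diff_split:
  fixes f :: "'a \<Rightarrow> 'b::field"
  assumes "finite A" "S \<subseteq> A"
  shows "prod f A = prod f S * prod f (A - S)"
  using assms by (metis mult.commute prod.subset_diff)

lemma prod_div_minus:
  fixes x :: "'a::field"
  assumes "x \<notin> S"
  shows "(\<Prod>v\<in>S. v / (v - x)) * (\<Prod>v\<in>S. x - v) = (\<Prod>v\<in>S. - v)"
  unfolding prod.distrib[symmetric]
  using assms by (intro prod.cong refl) (auto simp: divide_simps, simp add: algebra_simps)

lemma poly_cleared_fst_poly:
  assumes "finite U" "finite V" "x \<notin> V"
  shows "poly (cleared_fst_poly U V k) x = (\<Prod>v\<in>V. x - v) * subset_sum (insert x V) U (Suc k)"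
proof -
  have 1: "weight V U T * (\<Prod>v\<in>T. -v) * ((\<Prod>u\<in>U. 1 - x * u) * (\<Prod>v\<in>V - T. x - v))
    = (\<Prod>v\<in>V. x - v) * weight (insert x V) U T" if "T \<subseteq> V" for T
  proof -
    have "x \<notin> T" using that assms by auto
    then show ?thesis
      using assms that
      by (simp add: weight_insert_fst prod_diff_split[OF \<open>finite V\<close> that] prod_div_minus[symmetric] mult_ac)
  qed
  have 2: "weight V U T * (x ^ card (V - T) * (\<Prod>v\<in>T. x - v))
    = (\<Prod>v\<in>V. x - v) * weight (insert x V) U (insert x T)" if "T \<subseteq> V" for T
  proof -
    have "(\<Prod>v\<in>V - T. x - v) \<noteq> 0" using assms by auto
    then show ?thesis
      using assms that
      by (simp add: weight_insert_both prod_diff_split[OF \<open>finite V\<close> that])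
  qed
  show ?thesis
    using assms 1 2
    by (simp add: cleared_fst_poly_def subset_sum_def sum_subsets_of_card_insert poly_prod poly_sum
        sum_distrib_left distrib_left mult_ac)
qed

text \<open>
  The poles of \<open>subset_sum (insert x V) U (Suc k)\<close> at \<open>x \<in> V\<close> are only apparent. Writing
  \<open>V = insert x W\<close>, the summands with a pole are indexed by subsets of \<open>insert y (insert x W)\<close>,
  where \<open>y\<close> is the element moving towards \<open>x\<close>, that contain exactly one of \<open>x\<close> and \<open>y\<close>.
  For each \<open>T \<subseteq> W\<close> the residues belonging to \<open>insert x T\<close> and \<open>insert y T\<close> are opposite.
\<close>

lemma poly_cleared_fst_poly_root:
  assumes "finite U" "finite V" "x \<in> V"
  shows "poly (cleared_fst_poly U V k) x = 0"
proof -
  define W where "W = V - {x}"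
  have W: "V = insert x W" "x \<notin> W" "finite W" using assms by (auto simp: W_def)
  have z1: "(\<Prod>v\<in>V - T. x - v) = 0" if "T \<subseteq> W" for T
    using that W by (auto intro!: prod_zero)
  have z2: "(\<Prod>v\<in>insert x T. x - v) = 0" if "T \<subseteq> W" for T
    using that W by (meson finite_insert finite_subset insertI1 prod_zero right_minus_eq)
  let ?f = "\<lambda>T. weight V U T * (\<Prod>v\<in>T. -v) * ((\<Prod>u\<in>U. 1 - x * u) * (\<Prod>v\<in>V - T. x - v))"
  let ?g = "\<lambda>T. weight V U T * (x ^ card (V - T) * (\<Prod>v\<in>T. x - v))"
  have A: "(\<Sum>T\<in>subsets_of_card V (Suc k). ?f T) = (\<Sum>T\<in>subsets_of_card W k. ?f (insert x T))"
    unfolding W(1) sum_subsets_of_card_insert[OF W(3,2)] using z1 W(1) by simp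
  have B: "(\<Sum>T\<in>subsets_of_card V k. ?g T) = (\<Sum>T\<in>subsets_of_card W k. ?g T)"
  proof (cases k)
    case 0
    have "subsets_of_card V 0 = {{}}" "subsets_of_card W 0 = {{}}"
      using assms W by (auto simp: card_eq_0_iff dest: finite_subset)
    then show ?thesis using 0 by simp
  next
    case (Suc l)
    then show ?thesis
      unfolding W(1) Suc sum_subsets_of_card_insert[OF W(3,2)] using z2 by simp
  qed
  \<comment> \<open>Both terms reduce to \<open>weight W U T\<close>: adjoining \<open>x\<close> to the ground set and to the subset in
    \<open>?f\<close>, but only to the ground set in \<open>?g\<close>. The sign comes from the extra factor \<open>-x\<close> in
    \<open>?f\<close>.\<close>
  have C: "?f (insert x T) + ?g T = 0" if "T \<subseteq> W" for T
  proof -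
    have T: "x \<notin> T" "finite T" using that W finite_subset by auto
    have V1: "V - insert x T = W - T" and V2: "V - T = insert x (W - T)" using W T by auto
    have nz: "(\<Prod>v\<in>W - T. x - v) \<noteq> 0" using W by auto
    have "?f (insert x T) = - (weight W U T * x ^ Suc (card (W - T)) * (\<Prod>u\<in>U. 1 - x * u) * (\<Prod>v\<in>T. -v))"
      unfolding V1 unfolding W(1) weight_insert_both[OF W(3,2) that] using T nz by simp
    moreover have "?g T = weight W U T * x ^ Suc (card (W - T)) * (\<Prod>u\<in>U. 1 - x * u) * (\<Prod>v\<in>T. -v)"
      unfolding V2 unfolding W(1) weight_insert_fst[OF W(3,2) that] prod_div_minus[OF T(1), symmetric]
      using W by simp
    ultimately show ?thesis by simp
  qed
  have "poly (cleared_fst_poly U V k) x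
    = (\<Sum>T\<in>subsets_of_card V (Suc k). ?f T) + (\<Sum>T\<in>subsets_of_card V k. ?g T)"
    by (simp add: cleared_fst_poly_def poly_prod poly_sum)
  also have "\<dots> = (\<Sum>T\<in>subsets_of_card W k. ?f (insert x T) + ?g T)"
    unfolding A B by (simp add: sum.distrib)
  also have "\<dots> = 0" using C by (intro sum.neutral) auto
  finally show ?thesis .
qed

section \<open>Degree bounds\<close>

lemma degree_prod_linear_le:
  assumes "finite A" "\<And>x. x \<in> A \<Longrightarrow> degree (p x) \<le> 1"
  shows "degree (\<Prod>x\<in>A. p x) \<le> card A"
  using degree_prod_sum_le[OF assms(1), of p] sum_bounded_above[of A "degree \<circ> p" 1] assms(2)
  by fastforce

lemma degree_cleared_snd_poly:
  assumes "finite U" "finite V"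
  shows "degree (cleared_snd_poly U V k) \<le> card V + (card U - k)"
proof -
  have 1: "degree (\<Prod>v\<in>V. [:- v, 1:]) \<le> card V"
    using assms by (intro degree_prod_linear_le) auto
  have 2: "degree (\<Prod>w\<in>U - S. [:1, - w:]) \<le> card U - k" if "S \<in> subsets_of_card U k" for S
  proof -
    have "card (U - S) = card U - k" using that assms by (auto simp: card_Diff_subset finite_subset)
    then show ?thesis
      using degree_prod_linear_le[of "U - S" "\<lambda>w. [:1, - w:]"] assms by simp
  qed
  show ?thesis
    unfolding cleared_snd_poly_def using assms 1 2
    by (intro order.trans[OF degree_mult_le] add_mono degree_sum_le order.trans[OF degree_smult_le]) auto
qed

lemma degree_cleared_fst_poly:
  fixes U V :: "'a::field set"
  assumes "finite U" "finite V" "0 < card U"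
  shows "degree (cleared_fst_poly U V k) < card U + card V"
proof -
  have 1: "degree ((\<Prod>u\<in>U. [:1, -u:]) * (\<Prod>v\<in>V - T. [:-v, 1:])) < card U + card V"
    if T: "T \<in> subsets_of_card V (Suc k)" for T
  proof -
    have "degree (\<Prod>u\<in>U. [:1, -u:]) \<le> card U" "degree (\<Prod>v\<in>V - T. [:-v, 1:]) \<le> card (V - T)"
      using assms by (auto intro!: degree_prod_linear_le)
    moreover have "card (V - T) < card V"
      using T assms card_mono[of V T] by (auto simp: card_Diff_subset finite_subset)
    ultimately show ?thesis
      using degree_mult_le[of "\<Prod>u\<in>U. [:1, -u:]" "\<Prod>v\<in>V - T. [:-v, 1:]"] by linarith
  qed
  have 2: "degree ([:0, 1:] ^ card (V - T) * (\<Prod>v\<in>T. [:-v, 1:])) < card U + card V"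
    if T: "T \<in> subsets_of_card V k" for T
  proof -
    have f: "finite T" using T assms finite_subset by auto
    have "degree ([:0, 1 :: 'a:] ^ card (V - T)) \<le> card (V - T)"
      using degree_power_le[of "[:0, 1 :: 'a:]" "card (V - T)"] by simp
    moreover have "degree (\<Prod>v\<in>T. [:-v, 1:]) \<le> card T"
      using f by (intro degree_prod_linear_le) auto
    moreover have "card (V - T) + card T = card V"
      using T assms f by (auto simp: card_Diff_subset card_mono)
    ultimately show ?thesis
      using degree_mult_le[of "[:0, 1 :: 'a:] ^ card (V - T)" "\<Prod>v\<in>T. [:-v, 1:]"] assms(3) by linarith
  qed
  have "0 < card U + card V" using assms(3) by simp
  then show ?thesis
    unfolding cleared_fst_poly_def using assms 1 2
    by (intro degree_add_less degree_sum_less le_less_trans[OF degree_smult_le]) auto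
qed

section \<open>The symmetry\<close>

text \<open>
  The factor \<open>1 - a * inverse a\<close> kills all subsets that do not contain \<open>a\<close>. For the others,
  \<open>\<Prod>w. (1 - w / a)\<close> is exactly the inverse of the quotient that \<open>a\<close> contributes to the weight.
  With \<open>inverse a\<close> in place of \<open>a\<close>, the same statement evaluates the sum with the two sets
  exchanged.
\<close>

lemma subset_sum_insert_inverse:
  assumes "finite U" "a \<notin> U" "a \<noteq> 0" "finite V" "inverse a \<notin> V"
  shows "subset_sum (insert a U) (insert (inverse a) V) (Suc k) = subset_sum U V k"
proof -
  have z: "weight (insert a U) (insert (inverse a) V) S = 0" if "S \<subseteq> U" for S
  proof -
    have "(\<Prod>w\<in>insert a U - S. 1 - w * inverse a) = 0"
      using that assms by (intro prod_zero bexI[of _ a]) auto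
    then show ?thesis using assms by (simp add: weight_insert_snd)
  qed
  have e: "weight (insert a U) (insert (inverse a) V) (insert a S) = weight U V S" if "S \<subseteq> U" for S
  proof -
    have D: "insert a U - insert a S = U - S" using assms by auto
    have nz: "(\<Prod>v\<in>U - S. a - v) \<noteq> 0" using assms by auto
    have "(\<Prod>w\<in>U - S. 1 - w * inverse a) * a ^ card (U - S) = (\<Prod>v\<in>U - S. a - v)"
      using assms
      by (simp flip: prod_constant prod.distrib) (intro prod.cong refl, simp add: field_simps)
    then show ?thesis
      using assms that nz
      by (simp add: weight_insert_snd D weight_insert_both field_simps)
  qed
  show ?thesis
    unfolding subset_sum_def sum_subsets_of_card_insert[OF assms(1,2)] using z e by simp
qed

lemma subset_sum_0:
  assumes "finite A"
  shows "subset_sum A B 0 = (\<Prod>w\<in>A. \<Prod>v\<in>B. 1 - w * v)"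
proof -
  have "subsets_of_card A 0 = {{}}"
    using assms by (auto simp: card_eq_0_iff dest: finite_subset)
  then show ?thesis by (simp add: subset_sum_def weight_def)
qed

text \<open>
  The hypotheses \<open>0 \<notin> U\<close> and \<open>u v \<noteq> 1\<close> make the evaluation points \<open>1 / u\<close> legitimate and
  distinct from the elements of \<open>V\<close>, so that there are enough of them.
\<close>

lemma subset_sum_commute:
  fixes U V :: "'a::field set"
  assumes "finite U" "finite V" "0 \<notin> U" "\<And>u v. u \<in> U \<Longrightarrow> v \<in> V \<Longrightarrow> u * v \<noteq> 1"
    and "k \<le> card U" "k \<le> card V"
  shows "subset_sum U V k = subset_sum V U k"
  using assms
proof (induction k arbitrary: U V)
  case 0
  then show ?case
    by (simp add: subset_sum_0 prod.swap[of _ V U] mult.commute)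
next
  case (Suc k)
  then obtain x where "x \<in> V" by (metis card.empty equals0I not_less_eq_eq zero_le)
  define W where "W = V - {x}"
  have W: "V = insert x W" "x \<notin> W" "finite W"
    using \<open>x \<in> V\<close> \<open>finite V\<close> by (auto simp: W_def)
  have cW: "k \<le> card W" using Suc.prems(6) W by simp
  let ?A = "inverse ` U \<union> W"
  have inv: "inverse a \<notin> W" if "a \<in> U" for a
    using that Suc.prems(3) Suc.prems(4)[of a "inverse a"] W(1) by (metis insertI2 right_inverse)
  have cA: "card ?A = card U + card W"
    using Suc.prems(1) W inv by (subst card_Un_disjoint) (auto simp: card_image inj_on_def)
  have "cleared_snd_poly U W (Suc k) = cleared_fst_poly U W k"
  proof (rule poly_eqI_degree[where A = ?A])
    fix y assume "y \<in> ?A"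
    then show "poly (cleared_snd_poly U W (Suc k)) y = poly (cleared_fst_poly U W k) y"
    proof
      assume "y \<in> W"
      moreover have "poly (cleared_snd_poly U W (Suc k)) y = 0"
        using \<open>y \<in> W\<close> W by (auto simp: cleared_snd_poly_def poly_prod)
      ultimately show ?thesis using poly_cleared_fst_poly_root Suc.prems W by metis
    next
      assume "y \<in> inverse ` U"
      then obtain a where a: "a \<in> U" "y = inverse a" by blast
      define U' where "U' = U - {a}"
      have U': "U = insert a U'" "a \<notin> U'" "finite U'"
        using a Suc.prems(1) by (auto simp: U'_def)
      have y: "y \<notin> W" "y \<noteq> 0" "a \<noteq> 0" "inverse y = a" using inv a Suc.prems(3) by auto
      have "subset_sum U (insert y W) (Suc k) = subset_sum U' W k"
        unfolding U'(1) a(2) using U' y a W by (intro subset_sum_insert_inverse) auto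
      also have "\<dots> = subset_sum W U' k"
        using U' W Suc.prems cW by (intro Suc.IH) auto
      also have "\<dots> = subset_sum (insert y W) U (Suc k)"
        using subset_sum_insert_inverse[of W y U' k] U' y W by simp
      finally show ?thesis
        using poly_cleared_snd_poly[of U W y] poly_cleared_fst_poly[of U W y] Suc.prems(1) W y by simp
    qed
  next
    show "degree (cleared_snd_poly U W (Suc k)) < card ?A"
      unfolding cA using degree_cleared_snd_poly[OF Suc.prems(1) W(3), of "Suc k"] Suc.prems(5) by linarith
    show "degree (cleared_fst_poly U W k) < card ?A"
      unfolding cA using Suc.prems W by (intro degree_cleared_fst_poly) auto
  qed
  then have "(\<Prod>v\<in>W. x - v) * subset_sum U V (Suc k) = (\<Prod>v\<in>W. x - v) * subset_sum V U (Suc k)"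
    using poly_cleared_snd_poly[of U W x] poly_cleared_fst_poly[of U W x] Suc.prems(1) W by metis
  moreover have "(\<Prod>v\<in>W. x - v) \<noteq> 0" using W by auto
  ultimately show ?case by simp
qed

section \<open>Indexed families and indeterminates\<close>

lemma subset_sum_image:
  assumes "finite I" "inj_on f I" "inj_on g J"
  shows "subset_sum (f ` I) (g ` J) k = (\<Sum>S\<in>subsets_of_card I k.
     ((\<Prod>i\<in>S. f i ^ (card I - k)) * (\<Prod>j\<in>I - S. \<Prod>i\<in>J. 1 - f j * g i))
       / (\<Prod>i\<in>S. \<Prod>j\<in>I - S. f i - f j))"
proof -
  have "bij_betw ((`) f) (subsets_of_card I k) (subsets_of_card (f ` I) k)"
  proof (intro bij_betwI')
    fix S T assume "S \<in> subsets_of_card I k" "T \<in> subsets_of_card I k"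
    then show "f ` S = f ` T \<longleftrightarrow> S = T" using assms(2) by (simp add: inj_on_image_eq_iff)
  next
    fix S assume "S \<in> subsets_of_card I k"
    then show "f ` S \<in> subsets_of_card (f ` I) k"
      using assms(2) by (auto simp: card_image inj_on_subset)
  next
    fix S assume "S \<in> subsets_of_card (f ` I) k"
    then obtain T where "T \<subseteq> I" "S = f ` T" "card S = k" by (auto simp: subset_image_iff)
    then show "\<exists>T\<in>subsets_of_card I k. S = f ` T"
      using assms(2) by (auto simp: card_image inj_on_subset)
  qed
  then have "subset_sum (f ` I) (g ` J) k = (\<Sum>S\<in>subsets_of_card I k. weight (f ` I) (g ` J) (f ` S))"
    unfolding subset_sum_def by (rule sum.reindex_bij_betw[symmetric])
  also have "\<dots> = (\<Sum>S\<in>subsets_of_card I k.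
     ((\<Prod>i\<in>S. f i ^ (card I - k)) * (\<Prod>j\<in>I - S. \<Prod>i\<in>J. 1 - f j * g i))
       / (\<Prod>i\<in>S. \<Prod>j\<in>I - S. f i - f j))"
  proof (intro sum.cong refl)
    fix S assume S: "S \<in> subsets_of_card I k"
    have "f ` I - f ` S = f ` (I - S)"
      using S assms(2) by (simp add: inj_on_image_set_diff[of f I])
    moreover have "inj_on f S" "inj_on f (I - S)"
      using S assms(2) by (auto intro: inj_on_subset)
    ultimately show "weight (f ` I) (g ` J) (f ` S) =
     ((\<Prod>i\<in>S. f i ^ (card I - k)) * (\<Prod>j\<in>I - S. \<Prod>i\<in>J. 1 - f j * g i))
       / (\<Prod>i\<in>S. \<Prod>j\<in>I - S. f i - f j)"
      using S assms by (simp add: weight_def prod.reindex card_image)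
  qed
  finally show ?thesis .
qed

lemma indet_fun_eq_iff: "indet_fun x = (indet_fun y :: 'c::idom ratfun) \<longleftrightarrow> x = y"
proof
  assume "indet_fun x = (indet_fun y :: 'c ratfun)"
  then have "Poly_Mapping.lookup (Poly_Mapping.single (Poly_Mapping.single x 1) (1::'c)) (Poly_Mapping.single x (1::nat))
    = Poly_Mapping.lookup (Poly_Mapping.single (Poly_Mapping.single y 1) 1) (Poly_Mapping.single x (1::nat))"
    unfolding indet_fun_def to_fract_eq_iff by simp
  then have "Poly_Mapping.single x (1::nat) = Poly_Mapping.single y 1"
    by (simp add: lookup_single when_def split: if_splits)
  then have "Poly_Mapping.lookup (Poly_Mapping.single x (1::nat)) x = Poly_Mapping.lookup (Poly_Mapping.single y 1) x" by simp
  then show "x = y" by (simp add: lookup_single when_def split: if_splits)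
qed simp

lemma indet_fun_neq_1: "indet_fun x \<noteq> (1 :: 'c::idom ratfun)"
proof
  assume "indet_fun x = (1 :: 'c ratfun)"
  then have "Poly_Mapping.single (Poly_Mapping.single x (1::nat)) (1::'c) = 1"
    unfolding indet_fun_def by (metis to_fract_1 to_fract_eq_iff)
  then have "Poly_Mapping.lookup (Poly_Mapping.single (Poly_Mapping.single x (1::nat)) (1::'c)) 0 = 1"
    by (metis lookup_one_zero)
  then have "Poly_Mapping.single x (1::nat) = 0"
    by (simp add: lookup_single when_def split: if_splits)
  then have "Poly_Mapping.lookup (Poly_Mapping.single x (1::nat)) x = 0" by simp
  then show False by simp
qed

text \<open>
  The monomial \<open>x\<close> has coefficient 1 in \<open>x + y - x y\<close>.
\<close>

lemma indet_fun_oplus_neq_0: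
  assumes "x \<noteq> y"
  shows "indet_fun x \<oplus> indet_fun y \<noteq> (0 :: 'c::idom ratfun)"
proof
  let ?X = "Poly_Mapping.single x (1::nat)" and ?Y = "Poly_Mapping.single y (1::nat)"
  assume "indet_fun x \<oplus> indet_fun y = (0 :: 'c ratfun)"
  then have "to_fract (Poly_Mapping.single ?X (1::'c) + Poly_Mapping.single ?Y 1
      - Poly_Mapping.single ?X 1 * Poly_Mapping.single ?Y 1) = 0"
    by (simp only: indet_fun_def oplus_def to_fract_add to_fract_diff to_fract_mult)
  then have "Poly_Mapping.single ?X (1::'c) + Poly_Mapping.single ?Y 1 - Poly_Mapping.single (?X + ?Y) 1 = 0"
    unfolding to_fract_eq_0_iff mult_single by simp
  then have "Poly_Mapping.lookup (Poly_Mapping.single ?X (1::'c) + Poly_Mapping.single ?Y 1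
      - Poly_Mapping.single (?X + ?Y) 1) ?X = 0" by simp
  moreover have "?Y \<noteq> ?X"
    using assms by (metis lookup_single_eq lookup_single_not_eq zero_neq_one)
  moreover have "?X + ?Y \<noteq> ?X"
    by (metis add_cancel_left_right lookup_single_eq lookup_zero zero_neq_one)
  ultimately show False
    by (simp add: lookup_add lookup_minus lookup_single_not_eq)
qed

theorem theorem4p2:
  fixes m n k :: nat
  assumes "m \<ge> 1" and "n \<ge> 1" and "k \<le> min m n"
  shows
    "(\<Sum>S\<in>{S. S \<subseteq> {1..n} \<and> card S = k}.
        ((\<Prod>i\<in>S. (1 - zvar i) ^ (n - k)) *
         (\<Prod>j\<in>{1..n} - S. \<Prod>i\<in>{1..m}. zvar j \<oplus> avar i))
        / (\<Prod>i\<in>S. \<Prod>j\<in>{1..n} - S. zvar j - zvar i))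
   = (\<Sum>T\<in>{T. T \<subseteq> {1..m} \<and> card T = k}.
        ((\<Prod>i\<in>T. (1 - avar i) ^ (m - k)) *
         (\<Prod>j\<in>{1..m} - T. \<Prod>i\<in>{1..n}. zvar i \<oplus> avar j))
        / (\<Prod>i\<in>T. \<Prod>j\<in>{1..m} - T. avar j - (avar i :: 'c::idom ratfun)))"
proof -
  define u :: "nat \<Rightarrow> 'c ratfun" where "u i = 1 - zvar i" for i
  define v :: "nat \<Rightarrow> 'c ratfun" where "v j = 1 - avar j" for j
  have inj: "inj_on u {1..n}" "inj_on v {1..m}"
    by (auto simp: u_def v_def inj_on_def indet_fun_eq_iff)
  have oplus: "zvar i \<oplus> avar j = 1 - u i * v j" for i j
    unfolding u_def v_def by (simp add: oplus_def algebra_simps)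
  have ne: "u i * v j \<noteq> 1" for i j
    using indet_fun_oplus_neq_0[of "Z i" "Alpha j", where 'c = 'c] oplus[of i j] by auto
  have "subset_sum (u ` {1..n}) (v ` {1..m}) k = subset_sum (v ` {1..m}) (u ` {1..n}) k"
  proof (rule subset_sum_commute)
    show "0 \<notin> u ` {1..n}"
      using indet_fun_neq_1 by (fastforce simp: u_def)
    show "k \<le> card (u ` {1..n})" "k \<le> card (v ` {1..m})"
      using assms(3) inj by (simp_all add: card_image)
  qed (use ne in auto)
  moreover have "zvar j - zvar i = u i - u j" "avar j - avar i = v i - v j" for i j
    by (simp_all add: u_def v_def)
  ultimately show ?thesis
    unfolding subset_sum_image[OF finite_atLeastAtMost inj(1,2)] subset_sum_image[OF finite_atLeastAtMost inj(2,1)]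
    by (simp only: oplus card_atLeastAtMost diff_Suc_1 u_def[symmetric] v_def[symmetric] mult.commute[of "v _"])
qed

end
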